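(* Let $q$ be a prime power, $1\le s\le 4$, and $\delta,\varepsilon\in\mathbb F_q^*$ with $\delta^2\varepsilon\neq1$. If $\delta^3\varepsilon^2+(1-3\delta)\varepsilon+1\neq0$, then there exists $x\in\mathbb F_{q^5}$ satisfying simultaneously $$\varepsilon\,\mathrm N_{q^5/q}(x)=-1\quad\text{and}\quad \delta^2\varepsilon x^{q^s}-\delta\varepsilon x^{q^{2s}+q^s+1}(1-x)^{q^{3s}}+(1-x)^{q^s+1}=0.$$
   Context: $\mathrm N_{q^5/q}(x)=x^{1+q+q^2+q^3+q^4}$. *)

theory Defs
  imports "HOL-Number_Theory.Number_Theory" "HOL-Library.Cardinality"
begin

definition is_subfield :: "'a::field set \<Rightarrow> bool" where
  "is_subfield K \<longleftrightarrow>
     0 \<in> K \<and> 1 \<in> K \<and>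
     (\<forall>a\<in>K. \<forall>b\<in>K. a + b \<in> K \<and> a * b \<in> K) \<and>
     (\<forall>a\<in>K. - a \<in> K \<and> inverse a \<in> K)"

definition norm_q5 :: "nat \<Rightarrow> 'a::field \<Rightarrow> 'a" where
  "norm_q5 q x = x ^ (1 + q + q^2 + q^3 + q^4)"

end

theory Submission
  imports Defs "HOL-Algebra.Algebraic_Closure_Type"
begin

text \<open>
  Write \<open>x\<^sub>i\<close> for the conjugate of \<open>x\<close> under the \<open>i\<close>-th power of \<open>x \<mapsto> x ^ q ^ s\<close>. Eliminating between
  the equation, its conjugate and the norm condition gives a relation between \<open>x\<^sub>1\<close> and \<open>x\<^sub>0 x\<^sub>2\<close> only,
  \<open>x\<^sub>0 x\<^sub>2 = \<phi> x\<^sub>1\<close> for a Moebius involution \<open>\<phi>\<close> over \<open>F\<^sub>q\<close>, which is nondegenerate by the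
  hypothesis on \<open>\<delta>, \<epsilon>\<close>. Conversely, the 5-cycles of this recurrence with the prescribed norm are parametrised by
  a curve \<open>f (x\<^sub>0, x\<^sub>1) = 0\<close> of arithmetic genus at most one, with \<open>f\<close> symmetric and quadratic in each variable,
  and rotating the cycle is an automorphism of order 5 of that curve. A point of the curve on which Frobenius acts
  as the rotation (or as its square, depending on \<open>s\<close>) is a solution.

  Over the algebraic closure, \<open>f (X, X ^ q)\<close> has degree at least \<open>2 q + 1\<close>. At each of its roots, apart
  from a few degenerate ones, Frobenius acts on the 5-cycle either as a rotation, as desired, or as a reflection.
  A reflection of a 5-cycle fixes one of its members, which thus lies in \<open>F\<^sub>q\<close>, and every element of \<open>F\<^sub>q\<close> accounts
  for at most two reflections; this gives at most \<open>2 q\<close> roots. As a multiple root also forces a rotation, not all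
  roots are reflections.
\<close>

section \<open>Separable polynomials and symmetric biquadratics\<close>

text \<open>The polynomial splits into linear factors, and a repeated factor would give a common
  root with the derivative.\<close>

lemma card_roots_eq_degree:
  fixes p :: "'a::alg_closed_field poly"
  assumes "p \<noteq> 0" and simple: "\<And>x. poly p x = 0 \<Longrightarrow> poly (pderiv p) x \<noteq> 0"
  shows "card {x. poly p x = 0} = Polynomial.degree p"
proof -
  obtain A where A: "size A = Polynomial.degree p"
      "p = smult (lead_coeff p) (\<Prod>x\<in>#A. [:-x, 1:])"
    using alg_closed_imp_factorization[OF \<open>p \<noteq> 0\<close>] by blast
  have count: "count A x \<le> 1" for x
  proof (rule ccontr)
    assume "\<not> count A x \<le> 1"
    then have "{#x, x#} \<subseteq># A"
      by (simp add: subseteq_mset_def)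
    then obtain A' where A': "A = {#x, x#} + A'"
      by (metis subset_mset.less_eqE)
    define r where "r = smult (lead_coeff p) (\<Prod>x\<in>#A'. [:-x, 1:])"
    have r: "p = [:-x, 1:] * ([:-x, 1:] * r)"
      unfolding r_def by (subst A(2)) (simp only: A' image_mset_union prod_mset.union image_mset_add_mset
        prod_mset.add_mset image_mset_empty prod_mset.empty mult_1_right mult_smult_right mult.assoc)
    then have "poly p x = 0" "poly (pderiv p) x = 0"
      by (simp_all only: r pderiv_mult poly_mult poly_add) simp_all
    with simple show False by blast
  qed
  have "count A x = 1" if "x \<in># A" for x
    using count[of x] that count_greater_zero_iff[of A x] by linarith
  then have "card (set_mset A) = size A"
    by (simp add: size_multiset_overloaded_eq)
  moreover have "{x. poly p x = 0} = set_mset A"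
    using \<open>p \<noteq> 0\<close> by (subst A(2)) (auto simp: poly_prod_mset prod_mset_zero_iff)
  ultimately show ?thesis
    using A(1) by simp
qed

definition biquad :: "'a::comm_ring_1 \<Rightarrow> 'a \<Rightarrow> 'a \<Rightarrow> 'a \<Rightarrow> 'a \<Rightarrow> 'a \<Rightarrow> 'a \<Rightarrow> 'a \<Rightarrow> 'a" where
  "biquad k0 k1 k2 k3 k4 k5 x y =
     k0 * x\<^sup>2 * y\<^sup>2 + k1 * x * y * (x + y) + k2 * (x\<^sup>2 + y\<^sup>2) + k3 * x * y + k4 * (x + y) + k5"

text \<open>The partial derivative of \<open>biquad\<close> in \<open>x\<close>. When
  \<open>q\<close> is zero in the field, \<open>X ^ q\<close> has derivative zero, so this is also
  the derivative of f(X, X^q).\<close>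

definition biquad_dx :: "'a::comm_ring_1 \<Rightarrow> 'a \<Rightarrow> 'a \<Rightarrow> 'a \<Rightarrow> 'a \<Rightarrow> 'a \<Rightarrow> 'a \<Rightarrow> 'a" where
  "biquad_dx k0 k1 k2 k3 k4 x y =
     2 * k0 * x * y\<^sup>2 + k1 * (2 * x * y + y\<^sup>2) + 2 * k2 * x + k3 * y + k4"

lemma biquad_commute: "biquad k0 k1 k2 k3 k4 k5 x y = biquad k0 k1 k2 k3 k4 k5 y x"
  by (simp add: biquad_def algebra_simps)

section \<open>The Frobenius map\<close>

text \<open>The field may be infinite, so that the locale covers the finite field as well as its
  algebraic closure.\<close>

locale frobenius =
  fixes q :: nat and field_type :: "'a::field itself"
  assumes prime_char: "Factorial_Ring.prime CHAR('a)" and q_power: "\<exists>n>0. q = CHAR('a) ^ n"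
begin

lemma q_ge_2: "q \<ge> 2"
proof -
  obtain n where "n > 0" "q = CHAR('a) ^ n" using q_power by blast
  then show ?thesis
    using prime_ge_2_nat[OF prime_char] self_le_power[of "CHAR('a)" n] by linarith
qed

lemma of_nat_q: "of_nat q = (0::'a)"
  using q_power by auto

lemma frob_add: "(x + y) ^ q = x ^ q + (y::'a) ^ q"
  using q_power freshmans_dream'[OF prime_char] by blast

lemma frob_minus: "(- x) ^ q = - ((x::'a) ^ q)"
proof -
  have "(- x) ^ q + x ^ q = 0"
    using frob_add[of "- x" x] q_ge_2 by (simp add: power_0_left)
  then show ?thesis by (simp add: eq_neg_iff_add_eq_0)
qed

lemma frob_diff: "(x - y) ^ q = x ^ q - (y::'a) ^ q"
  using frob_add[of x "- y"] by (simp add: frob_minus)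

lemma frob_of_nat: "of_nat n ^ q = (of_nat n::'a)"
  using q_ge_2 by (induction n) (simp_all add: frob_add)

lemma frob_numeral: "numeral n ^ q = (numeral n::'a)"
  using frob_of_nat[of "numeral n"] by simp

lemmas frob_simps = frob_add frob_minus frob_diff frob_numeral power_mult_distrib power_divide

lemma frob_eq_iff: "x ^ q = y ^ q \<longleftrightarrow> x = (y::'a)"
proof -
  have "x ^ q = y ^ q \<longleftrightarrow> (x - y) ^ q = 0"
    by (simp add: frob_diff)
  then show ?thesis using q_ge_2 by simp
qed

lemma frob_power2: "(x\<^sup>2) ^ q = ((x::'a) ^ q)\<^sup>2"
  by (simp add: power_mult_distrib power2_eq_square)

lemma card_frob_fixed: "finite {x::'a. x ^ q = x}" "card {x::'a. x ^ q = x} \<le> q"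
proof -
  let ?p = "Polynomial.monom 1 q - Polynomial.monom 1 1 :: 'a poly"
  have roots: "{x. poly ?p x = 0} = {x. x ^ q = x}"
    by (auto simp: poly_monom)
  have "Polynomial.coeff ?p q = 1"
    using q_ge_2 by simp
  then have "?p \<noteq> 0" by (metis coeff_0 zero_neq_one)
  moreover have "Polynomial.degree ?p \<le> q"
    using q_ge_2 by (intro degree_diff_le) (auto simp: degree_monom_eq)
  ultimately show "finite {x::'a. x ^ q = x}" "card {x::'a. x ^ q = x} \<le> q"
    using poly_roots_finite[of ?p] card_poly_roots_bound[of ?p] roots by auto
qed

end

section \<open>Frobenius on a symmetric correspondence\<close>

text \<open>The hypothesis on \<open>biquad_dx\<close> makes f(X, X^q) separable, so it has as many
  roots as its degree, which is \<open>2 * q + 2\<close> for \<open>k0 \<noteq> 0\<close> and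
  \<open>2 * q + 1\<close> otherwise.\<close>

lemma card_frobenius_correspondence_roots:
  fixes k0 k1 k2 k3 k4 k5 :: "'a::alg_closed_field"
  assumes "frobenius TYPE('a) q" and "k0 \<noteq> 0 \<or> k1 \<noteq> 0"
    and simple: "\<And>x. biquad k0 k1 k2 k3 k4 k5 x (x ^ q) = 0 \<Longrightarrow> biquad_dx k0 k1 k2 k3 k4 x (x ^ q) \<noteq> 0"
  shows "card {x. biquad k0 k1 k2 k3 k4 k5 x (x ^ q) = 0} \<ge> 2 * q + 1"
proof -
  interpret frobenius q "TYPE('a)" by fact
  define p where "p = Polynomial.monom k0 (2 * q + 2) + Polynomial.monom k1 (q + 2)
    + Polynomial.monom k1 (2 * q + 1)
    + Polynomial.monom k2 2 + Polynomial.monom k2 (2 * q) + Polynomial.monom k3 (q + 1)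
    + Polynomial.monom k4 1 + Polynomial.monom k4 q + Polynomial.monom k5 0"
  have powers: "x ^ (2 * q + 2) = x\<^sup>2 * (x ^ q)\<^sup>2" "x ^ (q + 2) = x\<^sup>2 * x ^ q"
    "x ^ (2 * q + 1) = x * (x ^ q)\<^sup>2" "x ^ (2 * q) = (x ^ q)\<^sup>2" "x ^ (q + 1) = x * x ^ q" for x :: 'a
    by (simp_all add: power_add power_mult power2_eq_square mult_ac power_mult_distrib)
  have poly_p: "poly p x = biquad k0 k1 k2 k3 k4 k5 x (x ^ q)" for x
    unfolding p_def biquad_def poly_add poly_monom powers by (simp add: algebra_simps power2_eq_square)
  have poly_dp: "poly (pderiv p) x = biquad_dx k0 k1 k2 k3 k4 x (x ^ q)" for x
    by (simp add: p_def biquad_dx_def pderiv_add pderiv_monom poly_monom of_nat_q power_add power_mult power2_eq_square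
         algebra_simps)
  \<comment> \<open>The exponent \<open>q + 2\<close> carries \<open>k1\<close> as well;
    \<open>q \<ge> 2\<close> keeps it apart from \<open>2 * q + 1\<close>.\<close>
  have coeffs: "Polynomial.coeff p (2 * q + 2) = k0" "k0 = 0 \<Longrightarrow> Polynomial.coeff p (2 * q + 1) = k1"
    using q_ge_2 by (auto simp: p_def)
  then have "Polynomial.degree p \<ge> 2 * q + 1"
    using assms(2) le_degree[of p "2 * q + 2"] le_degree[of p "2 * q + 1"] by fastforce
  moreover from this have "p \<noteq> 0" by auto
  ultimately show ?thesis
    using card_roots_eq_degree[of p] simple by (simp add: poly_p poly_dp)
qed

text \<open>The 5-cycles are abstract so that the count applies both to adjacent members and to
  members at distance two. \<open>S\<close> collects the degenerate values, \<open>factor\<close>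
  says that the roots of \<open>f x1\<close> are the two neighbours of \<open>x1\<close>, and
  \<open>G\<close> confines the members at distance two from a given one.\<close>

lemma frobenius_rotates_some_pentagon:
  fixes k0 k1 k2 k3 k4 k5 :: "'a::alg_closed_field"
    and pent :: "'a \<Rightarrow> 'a \<Rightarrow> 'a \<Rightarrow> 'a \<Rightarrow> 'a \<Rightarrow> bool"
    and S :: "'a set" and G :: "'a \<Rightarrow> 'a set"
  defines "f \<equiv> biquad k0 k1 k2 k3 k4 k5"
  assumes frob: "frobenius TYPE('a) q"
    and lead: "k0 \<noteq> 0 \<or> k1 \<noteq> 0"
    and fixed: "k0 ^ q = k0" "k1 ^ q = k1" "k2 ^ q = k2" "k3 ^ q = k3" "k4 ^ q = k4" "k5 ^ q = k5"
    and S: "0 \<in> S" "1 \<in> S" "\<And>x. x \<in> S \<Longrightarrow> x ^ q = x" "finite S" "card S \<le> 4"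
    and S_simple: "\<And>x. x \<in> S \<Longrightarrow> f x x = 0 \<Longrightarrow> biquad_dx k0 k1 k2 k3 k4 x x \<noteq> 0"
    and extend: "\<And>x y. x \<notin> S \<Longrightarrow> f x y = 0 \<Longrightarrow> \<exists>z v w. pent x y z v w"
    and rotate: "\<And>x0 x1 x2 x3 x4. pent x0 x1 x2 x3 x4 \<Longrightarrow> pent x1 x2 x3 x4 x0"
    and reflect: "\<And>x0 x1 x2 x3 x4. pent x0 x1 x2 x3 x4 \<Longrightarrow> pent x1 x0 x4 x3 x2"
    and unique: "\<And>x0 x1 x2 x3 x4 y2 y3 y4. pent x0 x1 x2 x3 x4 \<Longrightarrow> pent x0 x1 y2 y3 y4 \<Longrightarrow>
      y2 = x2 \<and> y3 = x3 \<and> y4 = x4"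
    and power: "\<And>x0 x1 x2 x3 x4. pent x0 x1 x2 x3 x4 \<Longrightarrow>
      pent (x0 ^ q) (x1 ^ q) (x2 ^ q) (x3 ^ q) (x4 ^ q)"
    and regular: "\<And>x0 x1 x2 x3 x4. pent x0 x1 x2 x3 x4 \<Longrightarrow> x0 \<notin> S"
    and factor: "\<And>x0 x1 x2 x3 x4. pent x0 x1 x2 x3 x4 \<Longrightarrow> k0 * x1\<^sup>2 + k1 * x1 + k2 \<noteq> 0"
      "\<And>x0 x1 x2 x3 x4 z. pent x0 x1 x2 x3 x4 \<Longrightarrow>
        f x1 z = (k0 * x1\<^sup>2 + k1 * x1 + k2) * (z - x0) * (z - x2)"
    and chord: "\<And>x0 x1 x2 x3 x4. pent x0 x1 x2 x3 x4 \<Longrightarrow> x2 \<in> G x0"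
    and card_G: "\<And>x. x \<notin> S \<Longrightarrow> finite (G x) \<and> card (G x) \<le> 2"
  shows "\<exists>x. pent x (x ^ q) (x ^ q ^ 2) (x ^ q ^ 3) (x ^ q ^ 4) \<and> x ^ q ^ 5 = x"
proof (rule ccontr)
  assume contr: "\<not> ?thesis"
  interpret frobenius q "TYPE('a)" by fact
  have no_rotation: "(x ^ q) ^ q \<noteq> x2" if P: "pent x (x ^ q) x2 x3 x4" for x x2 x3 x4
  proof
    assume x2: "(x ^ q) ^ q = x2"
    \<comment> \<open>The Frobenius image and the rotation of the cycle both begin with
      \<open>x ^ q\<close>, \<open>x2\<close>, so they coincide.\<close>
    have "x2 ^ q = x3 \<and> x3 ^ q = x4 \<and> x4 ^ q = x"
      using power[OF P] unfolding x2 by (intro unique[OF rotate[OF P]])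
    then have "x2 = x ^ q ^ 2" "x3 = x ^ q ^ 3" "x4 = x ^ q ^ 4" "x ^ q ^ 5 = x"
      unfolding x2[symmetric] by (auto simp: eval_nat_numeral mult.assoc simp flip: power_mult)
    with P have "pent x (x ^ q) (x ^ q ^ 2) (x ^ q ^ 3) (x ^ q ^ 4) \<and> x ^ q ^ 5 = x"
      by simp
    with contr show False by blast
  qed
  have f_power: "f x y ^ q = f (x ^ q) (y ^ q)" for x y
    by (simp add: f_def biquad_def frob_simps frob_power2 fixed)
  have reflection: "\<exists>x2 x3 x4. pent x (x ^ q) x2 x3 x4 \<and> (x ^ q) ^ q = x \<and> x \<noteq> x2"
    if x: "f x (x ^ q) = 0" "x \<notin> S" for x
  proof -
    obtain x2 x3 x4 where P: "pent x (x ^ q) x2 x3 x4"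
      using extend x by blast
    \<comment> \<open>Frobenius carries the edge from \<open>x\<close> to \<open>x ^ q\<close> to an
      edge at \<open>x ^ q\<close>, which must end at one of the neighbours \<open>x\<close> and
      \<open>x2\<close>; ending at \<open>x2\<close> would be a rotation.\<close>
    have "f (x ^ q) ((x ^ q) ^ q) = 0"
      using x q_ge_2 by (simp flip: f_power)
    then have "(x ^ q) ^ q = x \<or> (x ^ q) ^ q = x2"
      using factor[OF P] by simp
    with no_rotation[OF P] have "(x ^ q) ^ q = x" "x \<noteq> x2"
      by auto
    with P show ?thesis by blast
  qed
  have simple: "biquad_dx k0 k1 k2 k3 k4 x (x ^ q) \<noteq> 0" if x: "f x (x ^ q) = 0" for x
  proof (cases "x \<in> S")
    case True
    then show ?thesis using S_simple[OF True] S(3)[OF True] x by simp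
  next
    case False
    then obtain x2 x3 x4 where P: "pent x (x ^ q) x2 x3 x4" and "x \<noteq> x2"
      using reflection x by blast
    define y where "y = x ^ q"
    \<comment> \<open>A quadratic with roots \<open>x\<close> and \<open>x2\<close> has derivative a
      leading coefficient times \<open>x - x2\<close> at \<open>x\<close>. The values at 1 and 0
      give its linear coefficient, in any characteristic.\<close>
    have "biquad_dx k0 k1 k2 k3 k4 x y - (k0 * y\<^sup>2 + k1 * y + k2) * (x - x2) =
        f y 1 - f y 0 - (k0 * y\<^sup>2 + k1 * y + k2) * ((1 - x) * (1 - x2) - (0 - x) * (0 - x2))"
      unfolding f_def biquad_def biquad_dx_def by (simp add: algebra_simps power2_eq_square)
    also have "\<dots> = 0"
      unfolding y_def factor(2)[OF P] by (simp add: algebra_simps)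
    finally have "biquad_dx k0 k1 k2 k3 k4 x y = (k0 * y\<^sup>2 + k1 * y + k2) * (x - x2)"
      by simp
    then show ?thesis
      using factor(1)[OF P] \<open>x \<noteq> x2\<close> by (simp add: y_def)
  qed
  define R where "R = {x. f x (x ^ q) = 0}"
  define K where "K = {x::'a. x ^ q = x}"
  have "R \<subseteq> S \<union> (\<Union>c\<in>K - S. G c)"
  proof
    fix x assume "x \<in> R"
    show "x \<in> S \<union> (\<Union>c\<in>K - S. G c)"
    proof (cases "x \<in> S")
      case False
      then obtain x2 x3 x4 where P: "pent x (x ^ q) x2 x3 x4" and x: "(x ^ q) ^ q = x"
        using reflection \<open>x \<in> R\<close> unfolding R_def by blast
      \<comment> \<open>The reflection exchanging \<open>x\<close> and \<open>x ^ q\<close> fixes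
        the opposite member \<open>x3\<close>, and \<open>x\<close> is at distance two from
        \<open>x3\<close>.\<close>
      have "x3 ^ q = x3"
        using unique[OF reflect[OF P] power[OF P, unfolded x]] by blast
      moreover have "pent x3 x4 x (x ^ q) x2"
        by (rule rotate[OF rotate[OF rotate[OF P]]])
      ultimately have "x3 \<in> K - S" "x \<in> G x3"
        using regular[of x3 x4 x] chord[of x3 x4 x] unfolding K_def by auto
      then show ?thesis by blast
    qed auto
  qed
  moreover have "finite K" "card K \<le> q"
    using card_frob_fixed unfolding K_def by auto
  ultimately have "card R \<le> card (S \<union> (\<Union>c\<in>K - S. G c))"
    using S card_G by (intro card_mono) auto
  also have "\<dots> \<le> card S + card (\<Union>c\<in>K - S. G c)"
    by (rule card_Un_le)
  also have "card (\<Union>c\<in>K - S. G c) \<le> (\<Sum>c\<in>K - S. card (G c))"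
    using \<open>finite K\<close> by (intro card_UN_le) auto
  also have "\<dots> \<le> (\<Sum>c\<in>K - S. 2)"
    using card_G by (intro sum_mono) auto
  also have "\<dots> = 2 * card (K - S)" by simp
  \<comment> \<open>With \<open>card S \<le> 4\<close> and 0, 1 in \<open>S\<close>, the count is at
    most \<open>4 + 2 * (q - 2) = 2 * q\<close>, one less than the lower bound.\<close>
  also have "card (K - S) \<le> card (K - {0, 1})"
    using \<open>finite K\<close> S by (intro card_mono) auto
  also have "card (K - {0, 1}) = card K - 2"
    using S by (subst card_Diff_subset) (auto simp: K_def)
  finally have "card R \<le> 2 * q"
    using \<open>card K \<le> q\<close> S(5) q_ge_2 by linarith
  moreover have "card R \<ge> 2 * q + 1"
    using card_frobenius_correspondence_roots[OF frob lead] simple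
    unfolding R_def f_def by blast
  ultimately show False by linarith
qed

section \<open>Pentagons: the 5-cycles of the Moebius recurrence\<close>

text \<open>
  The parameters are \<open>u = \<delta> * \<epsilon>\<close> and \<open>d = \<delta>\<close>; the discriminant \<open>D\<close> of the involution is \<open>\<delta>\<close> times the
  expression that the theorem assumes to be nonzero.
\<close>

locale pentagons =
  fixes u d a b c D :: "'a::field"
  assumes a_eq: "a = u - 1" and b_eq: "b = 1 - u * d" and c_eq: "c = d - 1" and D_eq: "D = b\<^sup>2 - a * c"
    and u_nz: "u \<noteq> 0" and d_nz: "d \<noteq> 0" and b_nz: "b \<noteq> 0" and D_nz: "D \<noteq> 0"
begin

lemmas param_eqs = a_eq b_eq c_eq D_eq
lemmas param_nz = u_nz d_nz b_nz D_nz

text \<open>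
  \<open>edge\<close> relates adjacent members of a 5-cycle and \<open>diagonal\<close> members at distance two. The \<open>special\<close>
  values are the finite members of the cycle through infinity (unique up to reversal), namely infinity, 1, 0, \<open>- c / b\<close>,
  \<open>- b / a\<close>; for \<open>a = 0\<close> the last one is itself infinite, and \<open>- b / a\<close> is harmlessly the junk value 0.
\<close>

definition edge :: "'a \<Rightarrow> 'a \<Rightarrow> 'a" where
  "edge = biquad (a * b) (b * (b - a)) (- (b\<^sup>2)) (- (b ^ 3 + 2 * b\<^sup>2 + a * c)) (b * (b - c)) (b * c)"

definition diagonal :: "'a \<Rightarrow> 'a \<Rightarrow> 'a" where
  "diagonal = biquad (u * b\<^sup>2) (u * b * c) 0 (u * c\<^sup>2 - d * b\<^sup>2 * u - d * a * b) (d * a * b) (d * b\<^sup>2)"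

definition special :: "'a set" where
  "special = {0, 1, - c / b, - b / a}"

text \<open>This is \<open>x * z = \<phi> y\<close> for
  \<open>\<phi> t = - (b * t + c) / (a * t + b)\<close>, cleared of denominators. Symmetry in
  \<open>y\<close> and \<open>x * z\<close> makes \<open>\<phi>\<close> an involution; its
  determinant is \<open>- D\<close>.\<close>

definition linked :: "'a \<Rightarrow> 'a \<Rightarrow> 'a \<Rightarrow> bool" where
  "linked x y z \<longleftrightarrow> a * y * (x * z) + b * (y + x * z) + c = 0"

text \<open>Listing every condition at all five positions makes rotation and reflection immediate.
  The last condition is the norm condition multiplied by \<open>\<delta>\<close>.\<close>

definition pentagon :: "'a \<Rightarrow> 'a \<Rightarrow> 'a \<Rightarrow> 'a \<Rightarrow> 'a \<Rightarrow> bool" where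
  "pentagon x0 x1 x2 x3 x4 \<longleftrightarrow>
     x0 \<notin> special \<and> x1 \<notin> special \<and> x2 \<notin> special \<and> x3 \<notin> special \<and> x4 \<notin> special \<and>
     edge x0 x1 = 0 \<and> edge x1 x2 = 0 \<and> edge x2 x3 = 0 \<and> edge x3 x4 = 0 \<and> edge x4 x0 = 0 \<and>
     linked x4 x0 x1 \<and> linked x0 x1 x2 \<and> linked x1 x2 x3 \<and> linked x2 x3 x4 \<and> linked x3 x4 x0 \<and>
     u * (x0 * x1 * x2 * x3 * x4) = - d"

lemma edge_commute: "edge x y = edge y x"
  by (simp add: edge_def biquad_commute)

lemma linked_commute: "linked x y z \<longleftrightarrow> linked z y x"
  by (simp add: linked_def mult_ac)

lemma special_iff: "x \<in> special \<longleftrightarrow> x = 0 \<or> x = 1 \<or> a * x + b = 0 \<or> b * x + c = 0"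
proof -
  have "x = - c / b \<longleftrightarrow> b * x + c = 0"
    using b_nz by (auto simp: field_simps add_eq_0_iff)
  moreover have "x = - b / a \<or> x = 0 \<longleftrightarrow> a * x + b = 0 \<or> x = 0"
    using b_nz by (cases "a = 0") (auto simp: field_simps add_eq_0_iff)
  ultimately show ?thesis
    unfolding special_def by blast
qed

lemma pentagon_rotate: "pentagon x0 x1 x2 x3 x4 \<Longrightarrow> pentagon x1 x2 x3 x4 x0"
  unfolding pentagon_def by (auto simp: mult_ac)

lemma pentagon_reflect: "pentagon x0 x1 x2 x3 x4 \<Longrightarrow> pentagon x1 x0 x4 x3 x2"
  unfolding pentagon_def by (auto simp: mult_ac edge_commute linked_commute)

text \<open>The factors display the neighbours of each special value in the cycle through infinity;
  a missing linear factor stands for the neighbour infinity. Hence a regular value has no special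
  neighbour.\<close>

lemma edge_special:
  shows "edge x 0 = - b * (x - 1) * (b * x + c)"
    and "edge x 1 = u * d * D * x"
    and "a * y + b = 0 \<Longrightarrow> a\<^sup>2 * edge x y = u * b * D * (b * x + c)"
    and "b * y + c = 0 \<Longrightarrow> b * edge x y = d * D * x * (a * x + b)"
proof -
  show "edge x 0 = - b * (x - 1) * (b * x + c)"
    unfolding edge_def biquad_def by (simp add: algebra_simps power2_eq_square)
  show "edge x 1 = u * d * D * x"
    unfolding edge_def biquad_def power_one unfolding param_eqs by Groebner_Basis.algebra
  show "a\<^sup>2 * edge x y = u * b * D * (b * x + c)" if "a * y + b = 0"
    using that param_eqs unfolding edge_def biquad_def by Groebner_Basis.algebra
  show "b * edge x y = d * D * x * (a * x + b)" if "b * y + c = 0"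
  proof -
    \<comment> \<open>Arranged so that \<open>y\<close> occurs only as \<open>b * y\<close>, which
      is then replaced by \<open>- c\<close>.\<close>
    have "b * edge x y = (b * y) * (a * x\<^sup>2 * (b * y) + b * (b - a) * x\<^sup>2 + (b - a) * x * (b * y)
        - b * (b * y) - (b ^ 3 + 2 * b\<^sup>2 + a * c) * x + b * (b - c)) - b ^ 3 * x\<^sup>2
        + b\<^sup>2 * (b - c) * x + b\<^sup>2 * c"
      unfolding edge_def biquad_def by Groebner_Basis.algebra
    also have "b * y = - c"
      using that by (simp add: add_eq_0_iff)
    finally show ?thesis
      unfolding param_eqs by Groebner_Basis.algebra
  qed
qed

lemma edge_regular:
  assumes "x \<notin> special" "edge x y = 0"
  shows "y \<notin> special"
  using assms edge_special(1,2)[of x] edge_special(3,4)[of y x] param_nz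
  unfolding special_iff by auto

text \<open>By Vieta, the roots of \<open>edge y v\<close> in \<open>v\<close> have product
  \<open>- (b * y + c) / (a * y + b)\<close>, which the link equates with \<open>x * z\<close>. As
  \<open>x\<close> is one root, \<open>z\<close> is the other.\<close>

lemma edge_factor:
  assumes "x \<noteq> 0" "edge x y = 0" "linked x y z"
  shows "edge y v = b * (a * y + b) * (y - 1) * (v - x) * (v - z)"
proof -
  \<comment> \<open>After multiplication by \<open>x\<close>, the claim involves \<open>z\<close>
    only through \<open>x * z\<close>.\<close>
  have "x * edge y v = x * (b * (a * y + b) * (y - 1) * (v - x) * (v - z))"
    using assms(2,3) unfolding edge_def biquad_def linked_def by Groebner_Basis.algebra
  with assms(1) show ?thesis by simp
qed

lemma edge_linked_step:
  assumes "x \<notin> special" "edge x y = 0" "linked x y z"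
  shows "edge y z = 0" "z \<notin> special"
proof -
  show "edge y z = 0"
    using edge_factor[of x y z z] assms by (simp add: special_iff)
  then show "z \<notin> special"
    using edge_regular assms by blast
qed

text \<open>The links at \<open>x1\<close> and \<open>x0\<close> determine the third and fifth
  member, and the norm condition the fourth. Each of the other three links, cleared of denominators,
  is a multiple of \<open>edge x0 x1\<close>.\<close>

lemma pentagon_extend:
  assumes x: "x0 \<notin> special" and e: "edge x0 x1 = 0"
  shows "pentagon x0 x1 (- (b * x1 + c) / ((a * x1 + b) * x0))
     (- d * (a * x0 + b) * (a * x1 + b) / (u * (b * x0 + c) * (b * x1 + c)))
     (- (b * x0 + c) / ((a * x0 + b) * x1))"
proof -
  have x1: "x1 \<notin> special" using edge_regular x e by blast
  define p0 p1 r0 r1 where defs: "p0 = a * x0 + b" "p1 = a * x1 + b" "r0 = b * x0 + c" "r1 = b * x1 + c"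
  have nz: "x0 \<noteq> 0" "x1 \<noteq> 0" "p0 \<noteq> 0" "p1 \<noteq> 0" "r0 \<noteq> 0" "r1 \<noteq> 0"
    using x x1 by (auto simp: special_iff defs)
  define x2 x3 x4 where x234: "x2 = - r1 / (p1 * x0)" "x3 = - d * p0 * p1 / (u * r0 * r1)" "x4 = - r0 / (p0 * x1)"
  have mults: "x2 * (p1 * x0) = - r1" "x3 * (u * r0 * r1) = - d * p0 * p1" "x4 * (p0 * x1) = - r0"
    using nz param_nz by (simp_all add: x234)
  have l1: "linked x0 x1 x2" and l0: "linked x4 x0 x1"
    using mults unfolding linked_def defs by Groebner_Basis.algebra+
  have l2: "linked x1 x2 x3"
  proof -
    have "(p1 * x0 * u * r0 * r1) * (a * x2 * (x1 * x3) + b * (x2 + x1 * x3) + c) =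
      - (d * a\<^sup>2 * x1 + u * c\<^sup>2) * edge x0 x1"
      using mults param_eqs unfolding edge_def biquad_def defs by Groebner_Basis.algebra
    then show ?thesis using nz param_nz e by (simp add: linked_def)
  qed
  have l4: "linked x3 x4 x0"
  proof -
    have "(p0 * x1 * u * r0 * r1) * (a * x4 * (x3 * x0) + b * (x4 + x3 * x0) + c) =
      - (d * a\<^sup>2 * x0 + u * c\<^sup>2) * edge x0 x1"
      using mults param_eqs unfolding edge_def biquad_def defs by Groebner_Basis.algebra
    then show ?thesis using nz param_nz e by (simp add: linked_def)
  qed
  have l3: "linked x2 x3 x4"
  proof -
    have "(p0 * p1 * x0 * x1 * u * r0 * r1) * (a * x3 * (x2 * x4) + b * (x3 + x2 * x4) + c) =
      a * (x3 * (u * r0 * r1)) * (x2 * (p1 * x0)) * (x4 * (p0 * x1)) + b * (x3 * (u * r0 * r1) * (p0 * p1 * x0 * x1)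
        + (x2 * (p1 * x0)) * (x4 * (p0 * x1)) * (u * r0 * r1)) + c * (p0 * p1 * x0 * x1 * u * r0 * r1)"
      by Groebner_Basis.algebra
    also have "\<dots> = D * (c - a * x0 * x1) * edge x0 x1"
      unfolding mults unfolding edge_def biquad_def defs unfolding param_eqs by Groebner_Basis.algebra
    finally have "(p0 * p1 * x0 * x1 * u * r0 * r1) * (a * x3 * (x2 * x4) + b * (x3 + x2 * x4) + c) =
      D * (c - a * x0 * x1) * edge x0 x1" .
    then show ?thesis using nz param_nz e by (simp add: linked_def)
  qed
  have norm: "u * (x0 * x1 * x2 * x3 * x4) = - d"
    using nz param_nz unfolding x234 by (simp add: field_simps)
  have 2: "edge x1 x2 = 0" "x2 \<notin> special" using edge_linked_step[OF x e l1] by auto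
  have 3: "edge x2 x3 = 0" "x3 \<notin> special" using edge_linked_step[OF x1 2(1) l2] by auto
  have 4: "edge x3 x4 = 0" "x4 \<notin> special" using edge_linked_step[OF 2(2) 3(1) l3] by auto
  have 5: "edge x4 x0 = 0" using edge_linked_step[OF 3(2) 4(1) l4] by auto
  have "pentagon x0 x1 x2 x3 x4"
    unfolding pentagon_def using x x1 e 2 3 4 5 l0 l1 l2 l3 l4 norm by blast
  then show ?thesis unfolding x234 defs .
qed

lemma linked_unique:
  assumes "linked x y z" "linked x y z'" "x \<notin> special" "y \<notin> special"
  shows "z' = z"
proof -
  have "(a * y + b) * x * z = (a * y + b) * x * z'"
    using assms(1,2) unfolding linked_def by Groebner_Basis.algebra
  with assms(3,4) show ?thesis by (simp add: special_iff)
qed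

lemma pentagon_unique:
  assumes "pentagon x0 x1 x2 x3 x4" "pentagon x0 x1 y2 y3 y4"
  shows "y2 = x2 \<and> y3 = x3 \<and> y4 = x4"
  using assms linked_unique unfolding pentagon_def by metis

lemma pentagon_edge_factor:
  assumes "pentagon x0 x1 x2 x3 x4"
  shows "(a * b) * x1\<^sup>2 + (b * (b - a)) * x1 + - (b\<^sup>2) \<noteq> 0"
    and "edge x1 z = ((a * b) * x1\<^sup>2 + (b * (b - a)) * x1 + - (b\<^sup>2)) * (z - x0) * (z - x2)"
proof -
  have eq: "(a * b) * x1\<^sup>2 + (b * (b - a)) * x1 + - (b\<^sup>2) = b * (a * x1 + b) * (x1 - 1)"
    by Groebner_Basis.algebra
  show "(a * b) * x1\<^sup>2 + (b * (b - a)) * x1 + - (b\<^sup>2) \<noteq> 0"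
    unfolding eq using assms b_nz by (auto simp: pentagon_def special_iff)
  show "edge x1 z = ((a * b) * x1\<^sup>2 + (b * (b - a)) * x1 + - (b\<^sup>2)) * (z - x0) * (z - x2)"
    unfolding eq using assms by (intro edge_factor) (auto simp: pentagon_def special_iff)
qed

text \<open>Solving the link for \<open>y\<close> and substituting into \<open>edge x y\<close>
  eliminates the middle member; this is the origin of the polynomial
  \<open>diagonal\<close>.\<close>

lemma linked_edge_diagonal:
  assumes "linked x y z"
  shows "(a * (x * z) + b)\<^sup>2 * edge x y = D * x * diagonal x z"
proof -
  have "y * (a * (x * z) + b) = - (b * (x * z) + c)"
    using assms unfolding linked_def by Groebner_Basis.algebra
  then show ?thesis
    using param_eqs unfolding edge_def diagonal_def biquad_def by Groebner_Basis.algebra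
qed

lemma pentagon_diagonal:
  assumes "pentagon x0 x1 x2 x3 x4"
  shows "diagonal x0 x2 = 0"
proof -
  have "D * x0 * diagonal x0 x2 = 0"
    using linked_edge_diagonal[of x0 x1 x2] assms by (simp add: pentagon_def)
  then show ?thesis using assms D_nz by (simp add: pentagon_def special_iff)
qed

text \<open>This is the equation of the theorem in terms of the conjugates. The norm condition and
  the link at \<open>x0\<close> eliminate \<open>x3\<close> and \<open>x4\<close>, the link at
  \<open>x1\<close> eliminates \<open>x2\<close>, and clearing denominators leaves
  \<open>edge x0 x1\<close>.\<close>

lemma pentagon_equation:
  assumes "pentagon x0 x1 x2 x3 x4"
  shows "u * d * x1 - u * x0 * x1 * x2 * (1 - x3) + (1 - x0) * (1 - x1) = 0"
proof -
  have prod: "u * (x0 * x1 * x2 * x3) * (b * x0 + c) = d * x1 * (a * x0 + b)"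
  proof -
    have "(x4 * x1) * (a * x0 + b) = - (b * x0 + c)" "u * (x0 * x1 * x2 * x3 * x4) = - d"
      using assms unfolding pentagon_def linked_def by (simp_all add: algebra_simps eq_neg_iff_add_eq_0)
    then show ?thesis by Groebner_Basis.algebra
  qed
  have link: "(x0 * x2) * (a * x1 + b) = - (b * x1 + c)"
    using assms unfolding pentagon_def linked_def by (simp add: algebra_simps eq_neg_iff_add_eq_0)
  have "(b * x0 + c) * (a * x1 + b) * (u * d * x1 - u * x0 * x1 * x2 * (1 - x3) + (1 - x0) * (1 - x1)) =
      (b * x0 + c) * (a * x1 + b) * (u * d * x1 + (1 - x0) * (1 - x1))
      - u * x1 * (b * x0 + c) * ((x0 * x2) * (a * x1 + b)) + (u * (x0 * x1 * x2 * x3) * (b * x0 + c)) * (a * x1 + b)"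
    by Groebner_Basis.algebra
  also have "\<dots> = edge x0 x1"
    unfolding prod link unfolding edge_def biquad_def unfolding param_eqs by Groebner_Basis.algebra
  also have "\<dots> = 0"
    using assms by (simp add: pentagon_def)
  finally have "(b * x0 + c) * (a * x1 + b) * (u * d * x1 - u * x0 * x1 * x2 * (1 - x3) + (1 - x0) * (1 - x1)) = 0" .
  then show ?thesis using assms by (auto simp: pentagon_def special_iff)
qed

lemma diagonal_special:
  shows "diagonal x 0 = d * b * (a * x + b)"
    and "diagonal x 1 = - u * d * (a * x + b) * (b * x + c)"
    and "a * y + b = 0 \<Longrightarrow> a\<^sup>2 * diagonal x y = u * b\<^sup>2 * D * x * (x - 1)"
    and "b * y + c = 0 \<Longrightarrow> diagonal x y = - d * D * (x - 1)"
proof -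
  show "diagonal x 0 = d * b * (a * x + b)"
    unfolding diagonal_def biquad_def by (simp add: algebra_simps power2_eq_square)
  show "diagonal x 1 = - u * d * (a * x + b) * (b * x + c)"
    unfolding diagonal_def biquad_def power_one unfolding param_eqs by Groebner_Basis.algebra
  show "a\<^sup>2 * diagonal x y = u * b\<^sup>2 * D * x * (x - 1)" if "a * y + b = 0"
  proof -
    have y: "a * y = - b"
      using that by (simp add: add_eq_0_iff)
    have "a\<^sup>2 * diagonal x y = u * b\<^sup>2 * x\<^sup>2 * (a * y)\<^sup>2 + u * b * c * x * (a * y) * (a * x + a * y)
        + (u * c\<^sup>2 - d * b\<^sup>2 * u - d * a * b) * a * x * (a * y) + d * a\<^sup>2 * b * (a * x + a * y) + d * a\<^sup>2 * b\<^sup>2"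
      unfolding diagonal_def biquad_def by Groebner_Basis.algebra
    then show ?thesis
      unfolding y unfolding param_eqs by Groebner_Basis.algebra
  qed
  show "diagonal x y = - d * D * (x - 1)" if "b * y + c = 0"
  proof -
    have y: "b * y = - c"
      using that by (simp add: add_eq_0_iff)
    have "b * diagonal x y = u * b * x\<^sup>2 * (b * y)\<^sup>2 + u * c * x * (b * y) * (b * x + b * y)
        + (u * c\<^sup>2 - d * b\<^sup>2 * u - d * a * b) * x * (b * y) + d * a * b * (b * x + b * y) + d * b ^ 3"
      unfolding diagonal_def biquad_def by Groebner_Basis.algebra
    also have "\<dots> = b * (- d * D * (x - 1))"
      unfolding y unfolding param_eqs by Groebner_Basis.algebra
    finally show ?thesis using b_nz mult_left_cancel by blast
  qed
qed

lemma diagonal_regular: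
  assumes "x \<notin> special" "diagonal x y = 0"
  shows "y \<notin> special"
  using assms diagonal_special(1,2)[of x] diagonal_special(3,4)[of y x] param_nz
  unfolding special_iff by auto

text \<open>On these two loci the middle member \<open>\<phi> (x * z)\<close> would be infinite or
  zero; the identities keep \<open>diagonal\<close> from vanishing there at regular values.\<close>

lemma diagonal_product:
  shows "a * (x * z) + b = 0 \<Longrightarrow> a * diagonal x z = - b * D * (1 - x) * (1 - z)"
    and "b * (x * z) + c = 0 \<Longrightarrow> diagonal x z = D * (1 - x) * (1 - z)"
proof -
  show "a * diagonal x z = - b * D * (1 - x) * (1 - z)" if "a * (x * z) + b = 0"
  proof -
    have y: "a * (x * z) = - b"
      using that by (simp add: add_eq_0_iff)
    then have "a \<noteq> 0" using b_nz by auto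
    have "a * (a * diagonal x z) = u * b\<^sup>2 * (a * (x * z))\<^sup>2 + u * b * c * a * (a * (x * z)) * (x + z)
        + (u * c\<^sup>2 - d * b\<^sup>2 * u - d * a * b) * a * (a * (x * z)) + d * a ^ 3 * b * (x + z) + d * a\<^sup>2 * b\<^sup>2"
      unfolding diagonal_def biquad_def by Groebner_Basis.algebra
    also have "\<dots> = - b * D * (a - a * (x + z) + (- b))"
      unfolding y unfolding param_eqs by Groebner_Basis.algebra
    also have "\<dots> = a * (- b * D * (1 - x) * (1 - z))"
      unfolding y[symmetric] by Groebner_Basis.algebra
    finally show ?thesis using \<open>a \<noteq> 0\<close> mult_left_cancel by blast
  qed
  show "diagonal x z = D * (1 - x) * (1 - z)" if "b * (x * z) + c = 0"
  proof -
    have y: "b * (x * z) = - c"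
      using that by (simp add: add_eq_0_iff)
    have "b * diagonal x z = u * b * (b * (x * z))\<^sup>2 + u * b * c * (b * (x * z)) * (x + z)
        + (u * c\<^sup>2 - d * b\<^sup>2 * u - d * a * b) * (b * (x * z)) + d * a * b\<^sup>2 * (x + z) + d * b ^ 3"
      unfolding diagonal_def biquad_def by Groebner_Basis.algebra
    also have "\<dots> = D * (b - b * (x + z) + (- c))"
      unfolding y unfolding param_eqs by Groebner_Basis.algebra
    also have "\<dots> = b * (D * (1 - x) * (1 - z))"
      unfolding y[symmetric] by Groebner_Basis.algebra
    finally show ?thesis using b_nz by simp
  qed
qed

text \<open>Since \<open>\<phi>\<close> is an involution, the middle member is recovered as
  \<open>\<phi> (x0 * x2)\<close>.\<close>

lemma pentagon_extend_diagonal: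
  assumes x: "x0 \<notin> special" and g: "diagonal x0 x2 = 0"
  shows "\<exists>x1 x3 x4. pentagon x0 x1 x2 x3 x4"
proof -
  have x2: "x2 \<notin> special" using diagonal_regular x g by blast
  have nz: "a * (x0 * x2) + b \<noteq> 0" "b * (x0 * x2) + c \<noteq> 0"
    using diagonal_product[of x0 x2] x x2 g param_nz by (auto simp: special_iff)
  define x1 where "x1 = - (b * (x0 * x2) + c) / (a * (x0 * x2) + b)"
  have "x1 * (a * (x0 * x2) + b) = - (b * (x0 * x2) + c)"
    using nz by (simp add: x1_def)
  then have l: "linked x0 x1 x2"
    unfolding linked_def by Groebner_Basis.algebra
  have "edge x0 x1 = 0"
    using linked_edge_diagonal[OF l] nz g by simp
  then obtain z v w where P: "pentagon x0 x1 z v w"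
    using pentagon_extend[OF x] by blast
  then have "z = x2"
    using linked_unique[OF l] unfolding pentagon_def by blast
  with P show ?thesis by blast
qed

lemma pentagon_unique_diagonal:
  assumes P: "pentagon x0 x1 x2 x3 x4" and Q: "pentagon x0 y1 x2 y3 y4"
  shows "y1 = x1 \<and> y3 = x3 \<and> y4 = x4"
proof -
  have *: "a * (x0 * x2) + b \<noteq> 0"
  proof
    assume 0: "a * (x0 * x2) + b = 0"
    have "linked x0 x1 x2" using P by (simp add: pentagon_def)
    then have "b * (x0 * x2) + c = 0"
      using 0 unfolding linked_def by Groebner_Basis.algebra
    \<comment> \<open>Numerator and denominator of \<open>\<phi>\<close> would vanish together,
      which nondegeneracy excludes.\<close>
    with 0 have "D = 0"
      using D_eq by Groebner_Basis.algebra
    with D_nz show False by simp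
  qed
  have "linked x0 x1 x2" "linked x0 y1 x2" using P Q by (auto simp: pentagon_def)
  then have "(a * (x0 * x2) + b) * x1 = (a * (x0 * x2) + b) * y1"
    unfolding linked_def by Groebner_Basis.algebra
  with * have "y1 = x1" by simp
  with P Q pentagon_unique show ?thesis by metis
qed

text \<open>Vieta again: the norm condition and the link at \<open>x0\<close> give the product
  \<open>x2 * x3\<close> of the roots. The summand \<open>+ 0\<close> is the coefficient
  \<open>k2\<close> in the form used by the counting lemma.\<close>

lemma pentagon_diagonal_factor:
  assumes P: "pentagon x0 x1 x2 x3 x4"
  shows "(u * b\<^sup>2) * x0\<^sup>2 + (u * b * c) * x0 + 0 \<noteq> 0"
    and "diagonal x0 z = ((u * b\<^sup>2) * x0\<^sup>2 + (u * b * c) * x0 + 0) * (z - x2) * (z - x3)"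
proof -
  have eq: "(u * b\<^sup>2) * x0\<^sup>2 + (u * b * c) * x0 + 0 = u * b * x0 * (b * x0 + c)"
    by Groebner_Basis.algebra
  show "(u * b\<^sup>2) * x0\<^sup>2 + (u * b * c) * x0 + 0 \<noteq> 0"
    unfolding eq using P param_nz by (auto simp: pentagon_def special_iff)
  have nz: "x2 \<noteq> 0" using P by (auto simp: pentagon_def special_iff)
  have prod: "u * x0 * (b * x0 + c) * (x2 * x3) = d * (a * x0 + b)"
  proof -
    have "(x4 * x1) * (a * x0 + b) = - (b * x0 + c)" "u * (x0 * x1 * x2 * x3 * x4) = - d"
      using P unfolding pentagon_def linked_def by (simp_all add: algebra_simps eq_neg_iff_add_eq_0)
    then show ?thesis by Groebner_Basis.algebra
  qed
  have "x2 * diagonal x0 z - x2 * (u * b * x0 * (b * x0 + c) * (z - x2) * (z - x3)) =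
     z * diagonal x0 x2 + b * (z - x2) * (u * x0 * (b * x0 + c) * (x2 * x3) - d * (a * x0 + b))"
    unfolding diagonal_def biquad_def by Groebner_Basis.algebra
  also have "\<dots> = 0"
    using pentagon_diagonal[OF P] prod by simp
  finally show "diagonal x0 z = ((u * b\<^sup>2) * x0\<^sup>2 + (u * b * c) * x0 + 0) * (z - x2) * (z - x3)"
    unfolding eq using nz by simp
qed

section \<open>Simplicity of roots at special values\<close>

definition edge_dx :: "'a \<Rightarrow> 'a \<Rightarrow> 'a" where
  "edge_dx = biquad_dx (a * b) (b * (b - a)) (- (b\<^sup>2)) (- (b ^ 3 + 2 * b\<^sup>2 + a * c)) (b * (b - c))"

definition diagonal_dx :: "'a \<Rightarrow> 'a \<Rightarrow> 'a" where
  "diagonal_dx = biquad_dx (u * b\<^sup>2) (u * b * c) 0 (u * c\<^sup>2 - d * b\<^sup>2 * u - d * a * b) (d * a * b)"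

lemma edge_dx_special:
  shows "a * y + b = 0 \<Longrightarrow> a\<^sup>2 * edge_dx x y = u * b\<^sup>2 * D"
    and "b * y + c = 0 \<Longrightarrow> b * edge_dx x y = d * D * (2 * a * x + b)"
proof -
  show "a\<^sup>2 * edge_dx x y = u * b\<^sup>2 * D" if "a * y + b = 0"
  proof -
    have y: "a * y = - b"
      using that by (simp add: add_eq_0_iff)
    have "a\<^sup>2 * edge_dx x y = 2 * a * b * x * (a * y)\<^sup>2 + b * (b - a) * (2 * a * x * (a * y) + (a * y)\<^sup>2)
        - 2 * b\<^sup>2 * a\<^sup>2 * x - (b ^ 3 + 2 * b\<^sup>2 + a * c) * a * (a * y) + a\<^sup>2 * b * (b - c)"
      unfolding edge_dx_def biquad_dx_def by Groebner_Basis.algebra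
    then show ?thesis
      unfolding y unfolding param_eqs by Groebner_Basis.algebra
  qed
  show "b * edge_dx x y = d * D * (2 * a * x + b)" if "b * y + c = 0"
  proof -
    have y: "b * y = - c"
      using that by (simp add: add_eq_0_iff)
    have "b * edge_dx x y = 2 * a * x * (b * y)\<^sup>2 + (b - a) * (2 * b * x * (b * y) + (b * y)\<^sup>2)
        - 2 * b ^ 3 * x - (b ^ 3 + 2 * b\<^sup>2 + a * c) * (b * y) + b\<^sup>2 * (b - c)"
      unfolding edge_dx_def biquad_dx_def by Groebner_Basis.algebra
    then show ?thesis
      unfolding y unfolding param_eqs by Groebner_Basis.algebra
  qed
qed

lemma diagonal_dx_special:
  shows "diagonal_dx x 1 = - u * d * (a * (b * x + c) + b * (a * x + b))"
    and "a * y + b = 0 \<Longrightarrow> a\<^sup>2 * diagonal_dx x y = u * b\<^sup>2 * D * (2 * x - 1)"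
    and "b * y + c = 0 \<Longrightarrow> b * diagonal_dx x y = - b * d * D"
proof -
  show "diagonal_dx x 1 = - u * d * (a * (b * x + c) + b * (a * x + b))"
    unfolding diagonal_dx_def biquad_dx_def power_one unfolding param_eqs by Groebner_Basis.algebra
  show "a\<^sup>2 * diagonal_dx x y = u * b\<^sup>2 * D * (2 * x - 1)" if "a * y + b = 0"
  proof -
    have y: "a * y = - b"
      using that by (simp add: add_eq_0_iff)
    have "a\<^sup>2 * diagonal_dx x y = 2 * u * b\<^sup>2 * x * (a * y)\<^sup>2 + u * b * c * (2 * a * x * (a * y) + (a * y)\<^sup>2)
        + (u * c\<^sup>2 - d * b\<^sup>2 * u - d * a * b) * a * (a * y) + d * a ^ 3 * b"
      unfolding diagonal_dx_def biquad_dx_def by Groebner_Basis.algebra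
    then show ?thesis
      unfolding y unfolding param_eqs by Groebner_Basis.algebra
  qed
  show "b * diagonal_dx x y = - b * d * D" if "b * y + c = 0"
  proof -
    have y: "b * y = - c"
      using that by (simp add: add_eq_0_iff)
    have "b * diagonal_dx x y = 2 * u * b * x * (b * y)\<^sup>2 + u * c * (2 * b * x * (b * y) + (b * y)\<^sup>2)
        + (u * c\<^sup>2 - d * b\<^sup>2 * u - d * a * b) * (b * y) + d * a * b\<^sup>2"
      unfolding diagonal_dx_def biquad_dx_def by Groebner_Basis.algebra
    then show ?thesis
      unfolding y unfolding param_eqs by Groebner_Basis.algebra
  qed
qed

text \<open>Special values lie on no pentagon, so simplicity of such roots is checked directly.
  Frobenius fixes them, hence only points with equal coordinates occur.\<close>

lemma edge_dx_nonzero: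
  assumes x: "x \<in> special" "edge x x = 0"
  shows "edge_dx x x \<noteq> 0"
proof
  assume dx: "edge_dx x x = 0"
  consider "x = 0" | "x = 1" | "a * x + b = 0" | "x \<noteq> 0" "b * x + c = 0"
    using x special_iff by blast
  then show False
  proof cases
    case 1
    \<comment> \<open>Vanishing of \<open>edge 0 0 = b * c\<close> forces \<open>c = 0\<close>,
      which leaves the derivative \<open>b * b\<close>.\<close>
    have "edge_dx 0 0 = b * (b - c)"
      by (simp add: edge_dx_def biquad_dx_def)
    then show False
      using 1 x(2) edge_special(1)[of 0] dx b_nz by auto
  next
    case 2
    then show False using x(2) edge_special(2)[of 1] param_nz by simp
  next
    case 3
    then show False using edge_dx_special(1)[of x x] dx param_nz by simp
  next
    case 4
    then have "a * x + b = 0"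
      using edge_special(4)[of x x] x(2) param_nz by simp
    then have "D = 0"
      using 4 D_eq by Groebner_Basis.algebra
    then show False using D_nz by simp
  qed
qed

lemma diagonal_dx_nonzero:
  assumes x: "x \<in> special" "diagonal x x = 0"
  shows "diagonal_dx x x \<noteq> 0"
proof
  assume dx: "diagonal_dx x x = 0"
  consider "x = 0" | "x = 1" | "x \<noteq> 1" "a * x + b = 0" | "b * x + c = 0"
    using x special_iff by blast
  then show False
  proof cases
    case 1
    then show False using x(2) diagonal_special(1)[of 0] param_nz by simp
  next
    case 2
    have "(a + b) * (b + c) = 0" "a * (b + c) + b * (a + b) = 0"
      using 2 x(2) dx diagonal_special(2)[of 1] diagonal_dx_special(1)[of 1] param_nz by simp_all
    then have "a + b = 0" using b_nz by auto
    moreover have "a + b = - u * c"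
      unfolding param_eqs by Groebner_Basis.algebra
    ultimately have "c = 0" using u_nz by simp
    with \<open>a + b = 0\<close> \<open>a * (b + c) + b * (a + b) = 0\<close> show False
      using b_nz by auto
  next
    case 3
    then have "x = 0"
      using diagonal_special(3)[of x x] x(2) param_nz by simp
    with 3 show False using b_nz by simp
  next
    case 4
    then show False using diagonal_dx_special(3)[of x x] dx param_nz by simp
  qed
qed

section \<open>Frobenius stability and bounds on the number of neighbours\<close>

lemma pentagon_power:
  assumes "frobenius TYPE('a) q" and ud: "u ^ q = u" "d ^ q = d"
    and P: "pentagon x0 x1 x2 x3 x4"
  shows "pentagon (x0 ^ q) (x1 ^ q) (x2 ^ q) (x3 ^ q) (x4 ^ q)"
proof -
  interpret frobenius q "TYPE('a)" by fact
  have abc: "a ^ q = a" "b ^ q = b" "c ^ q = c"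
    by (simp_all add: a_eq b_eq c_eq frob_simps ud)
  have "edge (x ^ q) (y ^ q) = edge x y ^ q" for x y
    by (simp add: edge_def biquad_def frob_simps frob_power2 abc power_commutes flip: power_mult)
      (simp add: power_mult frob_simps abc mult.commute)
  then have edge: "edge x y = 0 \<Longrightarrow> edge (x ^ q) (y ^ q) = 0" for x y
    using q_ge_2 by simp
  have "a * y ^ q * (x ^ q * z ^ q) + b * (y ^ q + x ^ q * z ^ q) + c = (a * y * (x * z) + b * (y + x * z) + c) ^ q"
    for x y z
    by (simp add: frob_simps abc)
  then have linked: "linked x y z \<Longrightarrow> linked (x ^ q) (y ^ q) (z ^ q)" for x y z
    unfolding linked_def using q_ge_2 by simp
  have "a * x ^ q + b = (a * x + b) ^ q" "b * x ^ q + c = (b * x + c) ^ q" for x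
    by (simp_all add: frob_simps abc)
  then have special: "x \<notin> special \<Longrightarrow> x ^ q \<notin> special" for x
    using q_ge_2 frob_eq_iff[of x 1] by (simp add: special_iff)
  have norm: "u * (x0 ^ q * x1 ^ q * x2 ^ q * x3 ^ q * x4 ^ q) = - d"
  proof -
    have "(u * (x0 * x1 * x2 * x3 * x4)) ^ q = (- d) ^ q"
      using P by (simp add: pentagon_def)
    then show ?thesis by (simp add: frob_simps ud)
  qed
  show ?thesis
    using P edge linked special norm unfolding pentagon_def by blast
qed

lemma special_power:
  assumes "frobenius TYPE('a) q" and ud: "u ^ q = u" "d ^ q = d" and "x \<in> special"
  shows "x ^ q = x"
proof -
  interpret frobenius q "TYPE('a)" by fact
  have "a ^ q = a" "b ^ q = b" "c ^ q = c"
    by (simp_all add: a_eq b_eq c_eq frob_simps ud)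
  with assms(4) q_ge_2 show ?thesis
    by (auto simp: special_def frob_simps power_0_left)
qed

lemma card_special: "finite special" "card special \<le> 4"
  unfolding special_def by (auto simp: card_insert_if)

lemma card_edge_roots:
  assumes "x \<notin> special"
  shows "finite {z. edge x z = 0} \<and> card {z. edge x z = 0} \<le> 2"
proof (cases "\<exists>y. edge x y = 0")
  case True
  then obtain y x2 x3 x4 where P: "pentagon x y x2 x3 x4"
    using pentagon_extend[OF assms] by blast
  have P': "pentagon x4 x y x2 x3"
    by (rule pentagon_rotate[OF pentagon_rotate[OF pentagon_rotate[OF pentagon_rotate[OF P]]]])
  have "{z. edge x z = 0} \<subseteq> {x4, y}"
    using pentagon_edge_factor[OF P'] by auto
  moreover have "card {x4, y} \<le> 2"
    by (simp add: card_insert_if)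
  ultimately show ?thesis
    by (meson card_mono finite.emptyI finite.insertI finite_subset order_trans)
qed auto

lemma card_diagonal_roots:
  assumes "x \<notin> special"
  shows "finite {z. diagonal x z = 0} \<and> card {z. diagonal x z = 0} \<le> 2"
proof (cases "\<exists>y. diagonal x y = 0")
  case True
  then obtain x1 x2 x3 x4 where P: "pentagon x x1 x2 x3 x4"
    using pentagon_extend_diagonal[OF assms] by blast
  have "{z. diagonal x z = 0} \<subseteq> {x2, x3}"
    using pentagon_diagonal_factor[OF P] by auto
  moreover have "card {x2, x3} \<le> 2"
    by (simp add: card_insert_if)
  ultimately show ?thesis
    by (meson card_mono finite.emptyI finite.insertI finite_subset order_trans)
qed auto

end

section \<open>Pentagons rotated by Frobenius\<close>

locale closed_pentagons = pentagons u d a b c D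
  for u d a b c D :: "'a::alg_closed_field" +
  fixes q :: nat
  assumes frob: "frobenius TYPE('a) q" and u_power: "u ^ q = u" and d_power: "d ^ q = d"
begin

interpretation frobenius q "TYPE('a)" by (rule frob)

lemma abc_power: "a ^ q = a" "b ^ q = b" "c ^ q = c"
  by (simp_all add: a_eq b_eq c_eq frob_simps u_power d_power)

text \<open>The counting lemma for the curve \<open>edge\<close>, with \<open>diagonal\<close>
  confining the members at distance two.\<close>

lemma frobenius_pentagon: "\<exists>x. pentagon x (x ^ q) (x ^ q ^ 2) (x ^ q ^ 3) (x ^ q ^ 4) \<and> x ^ q ^ 5 = x"
proof (rule frobenius_rotates_some_pentagon[where pent = pentagon and S = special
      and G = "\<lambda>x. {z. diagonal x z = 0}"
      and ?k0.0 = "a * b" and ?k1.0 = "b * (b - a)" and ?k2.0 = "- (b\<^sup>2)"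
      and ?k3.0 = "- (b ^ 3 + 2 * b\<^sup>2 + a * c)" and ?k4.0 = "b * (b - c)" and ?k5.0 = "b * c",
      folded edge_def edge_dx_def])
  show "frobenius TYPE('a) q" by (rule frob)
  show "a * b \<noteq> 0 \<or> b * (b - a) \<noteq> 0"
    using b_nz by auto
  show "(a * b) ^ q = a * b" "(b * (b - a)) ^ q = b * (b - a)" "(- (b\<^sup>2)) ^ q = - (b\<^sup>2)"
    "(- (b ^ 3 + 2 * b\<^sup>2 + a * c)) ^ q = - (b ^ 3 + 2 * b\<^sup>2 + a * c)"
    "(b * (b - c)) ^ q = b * (b - c)" "(b * c) ^ q = b * c"
    by (simp_all add: frob_simps abc_power power2_eq_square power3_eq_cube)
  show "0 \<in> special" "1 \<in> special"
    by (simp_all add: special_def)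
  show "\<exists>z v w. pentagon x y z v w" if "x \<notin> special" "edge x y = 0" for x y
    using pentagon_extend that by blast
  show "x0 \<notin> special" if "pentagon x0 x1 x2 x3 x4" for x0 x1 x2 x3 x4
    using that by (simp add: pentagon_def)
  show "x2 \<in> {z. diagonal x0 z = 0}" if "pentagon x0 x1 x2 x3 x4" for x0 x1 x2 x3 x4
    using pentagon_diagonal[OF that] by simp
qed (fact special_power[OF frob u_power d_power] card_special edge_dx_nonzero pentagon_rotate pentagon_reflect
  pentagon_unique pentagon_power[OF frob u_power d_power] pentagon_edge_factor card_diagonal_roots)+

text \<open>Listing a pentagon in steps of two interchanges the roles of \<open>edge\<close> and
  \<open>diagonal\<close>; Frobenius then acts as the square of the rotation.\<close>

lemma frobenius_pentagram: "\<exists>x. pentagon x (x ^ q ^ 3) (x ^ q) (x ^ q ^ 4) (x ^ q ^ 2) \<and> x ^ q ^ 5 = x"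
proof (rule frobenius_rotates_some_pentagon[where pent = "\<lambda>y0 y1 y2 y3 y4. pentagon y0 y3 y1 y4 y2" and S = special
      and G = "\<lambda>x. {z. edge x z = 0}"
      and ?k0.0 = "u * b\<^sup>2" and ?k1.0 = "u * b * c" and ?k2.0 = 0
      and ?k3.0 = "u * c\<^sup>2 - d * b\<^sup>2 * u - d * a * b" and ?k4.0 = "d * a * b" and ?k5.0 = "d * b\<^sup>2",
      folded diagonal_def diagonal_dx_def])
  show "frobenius TYPE('a) q" by (rule frob)
  show "u * b\<^sup>2 \<noteq> 0 \<or> u * b * c \<noteq> 0"
    using param_nz by auto
  show "(u * b\<^sup>2) ^ q = u * b\<^sup>2" "(u * b * c) ^ q = u * b * c" "(0::'a) ^ q = 0"
    "(u * c\<^sup>2 - d * b\<^sup>2 * u - d * a * b) ^ q = u * c\<^sup>2 - d * b\<^sup>2 * u - d * a * b"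
    "(d * a * b) ^ q = d * a * b" "(d * b\<^sup>2) ^ q = d * b\<^sup>2"
    using q_ge_2 by (simp_all add: frob_simps abc_power u_power d_power power2_eq_square power_0_left)
  show "0 \<in> special" "1 \<in> special"
    by (simp_all add: special_def)
  show "\<exists>z v w. pentagon x v y w z" if "x \<notin> special" "diagonal x y = 0" for x y
    using pentagon_extend_diagonal that by blast
  show "x0 \<notin> special" if "pentagon x0 x3 x1 x4 x2" for x0 x1 x2 x3 x4
    using that by (simp add: pentagon_def)
  show "x2 \<in> {z. edge x0 z = 0}" if "pentagon x0 x3 x1 x4 x2" for x0 x1 x2 x3 x4
    using that edge_commute by (simp add: pentagon_def)
  show "pentagon x1 x4 x2 x0 x3" if "pentagon x0 x3 x1 x4 x2" for x0 x1 x2 x3 x4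
    by (rule pentagon_rotate[OF pentagon_rotate[OF that]])
  show "pentagon x1 x3 x0 x2 x4" if "pentagon x0 x3 x1 x4 x2" for x0 x1 x2 x3 x4
    by (rule pentagon_reflect[OF pentagon_rotate[OF that]])
  show "y2 = x2 \<and> y3 = x3 \<and> y4 = x4" if "pentagon x0 x3 x1 x4 x2" "pentagon x0 y3 x1 y4 y2"
    for x0 x1 x2 x3 x4 y2 y3 y4
    using pentagon_unique_diagonal[OF that] by blast
  show "u * b\<^sup>2 * x1\<^sup>2 + u * b * c * x1 + 0 \<noteq> 0" if "pentagon x0 x3 x1 x4 x2" for x0 x1 x2 x3 x4
    by (rule pentagon_diagonal_factor(1)[OF pentagon_rotate[OF pentagon_rotate[OF that]]])
  show "diagonal x1 z = (u * b\<^sup>2 * x1\<^sup>2 + u * b * c * x1 + 0) * (z - x0) * (z - x2)"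
    if "pentagon x0 x3 x1 x4 x2" for x0 x1 x2 x3 x4 z
    using pentagon_diagonal_factor(2)[OF pentagon_rotate[OF pentagon_rotate[OF that]], of z] by (simp only: mult_ac)
qed (fact special_power[OF frob u_power d_power] card_special diagonal_dx_nonzero
  pentagon_power[OF frob u_power d_power] card_edge_roots)+

end

section \<open>Finite fields and descent from the algebraic closure\<close>

lemma frobenius_power:
  assumes "frobenius TYPE('a::field) q" "k > 0"
  shows "frobenius TYPE('a) (q ^ k)"
proof -
  interpret frobenius q "TYPE('a)" by fact
  obtain n where "n > 0" "q = CHAR('a) ^ n" using q_power by blast
  with assms(2) have "n * k > 0" "q ^ k = CHAR('a) ^ (n * k)"
    by (simp_all add: power_mult)
  with prime_char show ?thesis
    by unfold_locales blast+
qed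

text \<open>Multiplication by a nonzero \<open>x\<close> permutes the nonzero elements of
  \<open>K\<close>; comparing their products gives the claim.\<close>

lemma power_card_subfield:
  assumes K: "is_subfield K" "finite K" and x: "x \<in> K"
  shows "x ^ card K = x"
proof (cases "x = 0")
  case True
  then show ?thesis using K x by (auto simp: card_gt_0_iff)
next
  case False
  have inv: "inverse x \<in> K" "x * y \<in> K" "inverse x * y \<in> K" "0 \<in> K" if "y \<in> K" for y
    using K(1) x that unfolding is_subfield_def by auto
  have "(\<Prod>y\<in>K - {0}. x * y) = (\<Prod>y\<in>K - {0}. y)"
    by (rule prod.reindex_bij_witness[of _ "\<lambda>y. inverse x * y" "\<lambda>y. x * y"])
      (use False inv in auto)
  then have "x ^ card (K - {0}) * (\<Prod>y\<in>K - {0}. y) = (\<Prod>y\<in>K - {0}. y)"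
    by (simp add: prod.distrib)
  moreover have "(\<Prod>y\<in>K - {0}. y) \<noteq> 0"
    using K(2) by simp
  ultimately have "x ^ card (K - {0}) = 1" by simp
  moreover have "card K = Suc (card (K - {0}))"
    by (rule card.remove[OF K(2) inv(4)[OF x]])
  ultimately show ?thesis by simp
qed

lemma frobenius_finite_field:
  assumes "primepow q" "CARD('a::{field,finite}) = q ^ 5"
  shows "frobenius TYPE('a) q"
proof -
  obtain p n where p: "Factorial_Ring.prime p" "n > 0" "q = p ^ n"
    using assms(1) unfolding primepow_def by blast
  have CHAR: "Factorial_Ring.prime CHAR('a)"
    by (intro prime_CHAR_semidom finite_imp_CHAR_pos) simp
  have "CHAR('a) dvd p ^ (n * 5)"
    using CHAR_dvd_CARD[where 'a = 'a] assms(2) p(3) by (simp add: power_mult)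
  then have "CHAR('a) = p"
    using CHAR p(1) prime_dvd_power primes_dvd_imp_eq by blast
  with CHAR p show ?thesis
    by unfold_locales auto
qed

text \<open>Exponents of \<open>q\<close> count modulo 5. The pentagon rotated by Frobenius serves
  \<open>s = 1\<close>, and \<open>s = 4\<close> when read backwards; the pentagram serves
  \<open>s = 3\<close>, and \<open>s = 2\<close> backwards.\<close>

lemma (in closed_pentagons) exists_power_orbit:
  assumes "1 \<le> s" "s \<le> 4"
  shows "\<exists>x. x ^ q ^ 5 = x \<and> u * x ^ (1 + q + q\<^sup>2 + q ^ 3 + q ^ 4) = - d \<and>
    u * d * x ^ q ^ s - u * x * x ^ q ^ s * x ^ q ^ (2 * s) * (1 - x ^ q ^ (3 * s))
      + (1 - x) * (1 - x ^ q ^ s) = 0"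
proof -
  have reduce: "x ^ q ^ 6 = x ^ q" "x ^ q ^ 8 = x ^ q ^ 3" "x ^ q ^ 9 = x ^ q ^ 4" "x ^ q ^ 12 = x ^ q ^ 2"
    if x: "x ^ q ^ 5 = x" for x :: 'a
  proof -
    have step: "x ^ q ^ (5 + k) = x ^ q ^ k" for k
      by (simp add: power_add power_mult x)
    show "x ^ q ^ 6 = x ^ q" "x ^ q ^ 8 = x ^ q ^ 3" "x ^ q ^ 9 = x ^ q ^ 4" "x ^ q ^ 12 = x ^ q ^ 2"
      using step[of 1] step[of 3] step[of 4] step[of 2] step[of 7] by simp_all
  qed
  have norm: "x ^ (1 + q + q\<^sup>2 + q ^ 3 + q ^ 4) = x * x ^ q * x ^ q ^ 2 * x ^ q ^ 3 * x ^ q ^ 4" for x :: 'a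
    by (simp add: power_add)
  have reverse: "pentagon x0 x4 x3 x2 x1" if "pentagon x0 x1 x2 x3 x4" for x0 x1 x2 x3 x4
    by (rule pentagon_rotate[OF pentagon_reflect[OF that]])
  have "\<exists>x. x ^ q ^ 5 = x \<and> pentagon x (x ^ q ^ s) (x ^ q ^ (2 * s)) (x ^ q ^ (3 * s)) (x ^ q ^ (4 * s)) \<and>
    u * x ^ (1 + q + q\<^sup>2 + q ^ 3 + q ^ 4) = - d"
  proof -
    obtain x where x: "x ^ q ^ 5 = x" and P: "pentagon x (x ^ q) (x ^ q ^ 2) (x ^ q ^ 3) (x ^ q ^ 4)"
      using frobenius_pentagon by blast
    obtain y where y: "y ^ q ^ 5 = y" and Q: "pentagon y (y ^ q ^ 3) (y ^ q) (y ^ q ^ 4) (y ^ q ^ 2)"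
      using frobenius_pentagram by blast
    have Nx: "u * x ^ (1 + q + q\<^sup>2 + q ^ 3 + q ^ 4) = - d"
      using P unfolding norm pentagon_def by blast
    have "u * (y * y ^ q ^ 3 * y ^ q * y ^ q ^ 4 * y ^ q ^ 2) = - d"
      using Q unfolding pentagon_def by blast
    then have Ny: "u * y ^ (1 + q + q\<^sup>2 + q ^ 3 + q ^ 4) = - d"
      unfolding norm by (simp add: mult_ac)
    have x16: "x ^ q ^ 16 = x ^ q"
      using reduce(1)[OF x] x power_mult[of x "q ^ 5" "q ^ 11"] power_mult[of x "q ^ 5" "q ^ 6"]
      by (simp flip: power_add)
    consider "s = 1" | "s = 2" | "s = 3" | "s = 4"
      using assms by linarith
    then show ?thesis
    proof cases
      case 1
      then show ?thesis using x P Nx by auto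
    next
      case 2
      then show ?thesis using y reverse[OF Q] Ny by (intro exI[of _ y]) (simp add: reduce[OF y])
    next
      case 3
      then show ?thesis using y Q Ny by (intro exI[of _ y]) (simp add: reduce[OF y])
    next
      case 4
      then show ?thesis using x reverse[OF P] Nx by (intro exI[of _ x]) (simp add: reduce[OF x] x16)
    qed
  qed
  then show ?thesis
    using pentagon_equation by blast
qed

text \<open>The embedded field consists of fixed points and already has \<open>q\<close> elements,
  the most that \<open>X ^ q - X\<close> can have as roots.\<close>

lemma fixed_points_to_ac:
  assumes "frobenius TYPE('a::{field,finite}) q" "CARD('a) = q"
  shows "{x :: 'a alg_closure. x ^ q = x} = range to_ac"
proof -
  have "frobenius TYPE('a alg_closure) q"
    using assms(1) by (simp add: frobenius_def)
  then have fixed: "finite {x :: 'a alg_closure. x ^ q = x}" "card {x :: 'a alg_closure. x ^ q = x} \<le> q"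
    by (rule frobenius.card_frob_fixed)+
  have "y ^ q = y" for y :: 'a
    using power_card_subfield[of UNIV y] assms(2) by (simp add: is_subfield_def)
  then have "range (to_ac :: 'a \<Rightarrow> _) \<subseteq> {x. x ^ q = x}"
    by (auto simp flip: to_ac_power)
  moreover have "card (range (to_ac :: 'a \<Rightarrow> _)) = q"
    using assms(2) by (simp add: card_image inj_to_ac)
  ultimately show ?thesis
    using fixed card_seteq by metis
qed

theorem theorem4p10:
  fixes q s :: nat
    and Fq :: "'a::{field,finite} set"
    and \<delta> \<epsilon> :: 'a
  assumes "primepow q"
    and "CARD('a) = q ^ 5"
    and "is_subfield Fq" and "card Fq = q"
    and "1 \<le> s" and "s \<le> 4"
    and "\<delta> \<in> Fq - {0}" and "\<epsilon> \<in> Fq - {0}"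
    and "\<delta>^2 * \<epsilon> \<noteq> 1"
    and "\<delta>^3 * \<epsilon>^2 + (1 - 3 * \<delta>) * \<epsilon> + 1 \<noteq> 0"
  shows "\<exists>x::'a. \<epsilon> * norm_q5 q x = - 1 \<and>
           \<delta>^2 * \<epsilon> * x ^ (q ^ s)
           - \<delta> * \<epsilon> * x ^ (q ^ (2 * s) + q ^ s + 1) * (1 - x) ^ (q ^ (3 * s))
           + (1 - x) ^ (q ^ s + 1) = 0"
proof -
  have frob_field: "frobenius TYPE('a) q"
    using frobenius_finite_field assms by blast
  have frob_ac: "frobenius TYPE('a alg_closure) q"
    using frob_field by (simp add: frobenius_def)
  have nz: "\<delta> \<noteq> 0" "\<epsilon> \<noteq> 0"
    using assms by auto
  have fixed: "\<delta> ^ q = \<delta>" "\<epsilon> ^ q = \<epsilon>"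
    using power_card_subfield[of Fq] assms by auto
  define u where "u = \<delta> * \<epsilon>"
  have disc: "(1 - u * \<delta>)\<^sup>2 - (u - 1) * (\<delta> - 1) = \<delta> * (\<delta>^3 * \<epsilon>^2 + (1 - 3 * \<delta>) * \<epsilon> + 1)"
    unfolding u_def by Groebner_Basis.algebra
  \<comment> \<open>Here \<open>b \<noteq> 0\<close> is the hypothesis
    \<open>\<delta>^2 * \<epsilon> \<noteq> 1\<close>, and \<open>D \<noteq> 0\<close> follows from
    the last hypothesis through \<open>disc\<close>.\<close>
  interpret closed_pentagons "to_ac u" "to_ac \<delta>" "to_ac (u - 1)" "to_ac (1 - u * \<delta>)" "to_ac (\<delta> - 1)"
    "to_ac ((1 - u * \<delta>)\<^sup>2 - (u - 1) * (\<delta> - 1))" q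
  proof (intro closed_pentagons.intro pentagons.intro closed_pentagons_axioms.intro frob_ac)
    show "to_ac ((1 - u * \<delta>)\<^sup>2 - (u - 1) * (\<delta> - 1)) =
        (to_ac (1 - u * \<delta>))\<^sup>2 - to_ac (u - 1) * to_ac (\<delta> - 1)"
      by (simp only: to_ac_diff to_ac_mult to_ac_power)
    show "to_ac (1 - u * \<delta>) \<noteq> 0"
      using assms(9) unfolding to_ac_eq_0_iff by (simp add: u_def power2_eq_square mult_ac)
    show "to_ac ((1 - u * \<delta>)\<^sup>2 - (u - 1) * (\<delta> - 1)) \<noteq> 0"
      unfolding disc to_ac_eq_0_iff using nz assms(10) by simp
  qed (use nz in \<open>simp_all add: u_def fixed power_mult_distrib flip: to_ac_power to_ac_mult\<close>)
  obtain x where x: "x ^ q ^ 5 = x" "to_ac u * x ^ (1 + q + q\<^sup>2 + q ^ 3 + q ^ 4) = - to_ac \<delta>"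
    "to_ac u * to_ac \<delta> * x ^ q ^ s - to_ac u * x * x ^ q ^ s * x ^ q ^ (2 * s) * (1 - x ^ q ^ (3 * s))
      + (1 - x) * (1 - x ^ q ^ s) = 0"
    using exists_power_orbit assms by blast
  \<comment> \<open>The orbit closes after five steps, so \<open>x\<close> is fixed by the
    \<open>q ^ 5\<close>-th power map and lies in the original field.\<close>
  have "x \<in> range to_ac"
    using fixed_points_to_ac[OF frobenius_power[OF frob_field, of 5]] assms(2) x(1) by auto
  then obtain y where y: "x = to_ac y" by blast
  have "to_ac (u * y ^ (1 + q + q\<^sup>2 + q ^ 3 + q ^ 4)) = to_ac (- \<delta>)"
    using x(2) unfolding y by (simp only: to_ac_mult to_ac_power to_ac_minus)
  then have "\<delta> * (\<epsilon> * norm_q5 q y) = \<delta> * - 1"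
    unfolding to_ac_eq_iff by (simp add: u_def norm_q5_def mult_ac)
  then have norm: "\<epsilon> * norm_q5 q y = - 1"
    using nz mult_left_cancel by blast
  have "to_ac (u * \<delta> * y ^ q ^ s - u * y * y ^ q ^ s * y ^ q ^ (2 * s) * (1 - y ^ q ^ (3 * s))
      + (1 - y) * (1 - y ^ q ^ s)) = to_ac 0"
    using x(3) unfolding y by (simp only: to_ac_add to_ac_diff to_ac_mult to_ac_power to_ac_1 to_ac_0)
  then have eq: "u * \<delta> * y ^ q ^ s - u * y * y ^ q ^ s * y ^ q ^ (2 * s) * (1 - y ^ q ^ (3 * s))
      + (1 - y) * (1 - y ^ q ^ s) = 0"
    by (simp only: to_ac_eq_iff)
  have one_diff: "(1 - y) ^ q ^ k = 1 - y ^ q ^ k" if "k > 0" for k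
    using frobenius.frob_diff[OF frobenius_power[OF frob_field that], of 1 y] by simp
  have "\<delta>^2 * \<epsilon> * y ^ (q ^ s) - \<delta> * \<epsilon> * y ^ (q ^ (2 * s) + q ^ s + 1) * (1 - y) ^ (q ^ (3 * s))
      + (1 - y) ^ (q ^ s + 1) = 0"
    using eq assms(5) by (simp add: u_def one_diff power_add power2_eq_square mult_ac)
  with norm show ?thesis by blast
qed

end
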